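(* Let $n\ge 1$ be an integer and suppose that the Lonely Runner Conjecture is true for $n$ runners. Let $v_1,\dots,v_n$ be positive integers with $\gcd(v_1,\dots,v_n)=1$ and $$\sum_{S\subseteq [n]} v_S > \binom{n+1}{2}^{n-1}.$$ Then the Lonely Runner Conjecture is true for the $n+1$ runners with velocities $0,v_1,\dots,v_n$, that is, there is some $t\in\mathbb{R}$ such that $\|v_i t\|\ge \frac{1}{n+1}$ for every $i$ with $1\le i\le n$.
   Context: For $x\in\mathbb{R}$, $\|x\|$ denotes the distance from $x$ to a nearest integer. "The Lonely Runner Conjecture is true for $m+1$ runners" means: for all non-zero real numbers $w_1,\dots,w_m$ there is some $t\in\mathbb{R}$ such that $\|w_i t\|\ge\frac{1}{m+1}$ for all $1\le i\le m$ (so "for $n$ runners" is the statement with $n-1$ non-zero velocities; for zero velocities it is vacuous). Here $[n]=\{1,\dots,n\}$ and, for $S\subseteq[n]$, $v_S:=\gcd(v_i: i\in S)$, with $v_\emptyset=0$. *)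

theory Defs
  imports Complex_Main
begin

text \<open>By the library fact round_diff_minimal, \<^term>\<open>round x\<close> is an integer nearest to \<^term>\<open>x\<close>.\<close>

definition dist_int :: "real \<Rightarrow> real"
  where "dist_int x = \<bar>x - of_int (round x)\<bar>"

text \<open>The conjecture for \<^term>\<open>n\<close> runners, \<^term>\<open>n \<ge> (1::nat)\<close>, one of which is stationary:
  the other \<^term>\<open>n - (1::nat)\<close> runners have non-zero real velocities, indexed by \<^term>\<open>{1..<n::nat}\<close>.\<close>

definition lonely_runner_conjecture :: "nat \<Rightarrow> bool"
  where "lonely_runner_conjecture n \<longleftrightarrow>
    (\<forall>w :: nat \<Rightarrow> real. (\<forall>i\<in>{1..<n}. w i \<noteq> 0) \<longrightarrow>
      (\<exists>t :: real. \<forall>i\<in>{1..<n}. dist_int (w i * t) \<ge> 1 / real n))"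

end

theory Submission
  imports Defs "HOL-Library.FuncSet"
begin

text \<open>
  Let \<open>N = n(n+1)/2\<close>. The projection along \<open>v\<close> of the unit cube of \<open>\<real>\<^sup>n\<close> contains exactly
  \<open>\<Sum>\<^sub>S v\<^sub>S\<close> points of the projected lattice. They are represented by the vectors \<open>z\<close> with
  \<open>z\<^sub>i = \<lfloor>s v\<^sub>i\<rfloor> + [i \<notin> S]\<close>, where \<open>S \<noteq> \<emptyset>\<close>, \<open>0 \<le> s < 1\<close> and \<open>s v\<^sub>i\<close> is an integer for \<open>i \<in> S\<close>;
  modulo \<open>v\<close>, such a \<open>z\<close> determines \<open>s = min\<^sub>i z\<^sub>i / v\<^sub>i\<close> and the set \<open>S\<close> of its minimisers.
  The projected lattice modulo \<open>N\<close> has only \<open>N ^ (n - 1)\<close> classes, so two of these points are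
  congruent. This gives an integer vector \<open>u\<close>, not parallel to \<open>v\<close>, at sup-distance at most
  \<open>1 / N\<close> from the line \<open>\<real>v\<close>.

  If \<open>u\<^sub>i / v\<^sub>i < u\<^sub>j / v\<^sub>j\<close> are consecutive among the ratios \<open>u\<^sub>k / v\<^sub>k\<close>, then the combination
  \<open>w = (v\<^sub>i + v\<^sub>j) u - (u\<^sub>i + u\<^sub>j) v\<close> has no zero entry, since \<open>(u\<^sub>i + u\<^sub>j) / (v\<^sub>i + v\<^sub>j)\<close> lies strictly
  between the two ratios, and \<open>w\<^sub>i = - w\<^sub>j\<close>. Hence the conjecture for \<open>n\<close> runners gives
  a time at which all \<open>n\<close> velocities \<open>w\<^sub>k\<close> are at distance at least \<open>1 / n\<close> from the integers.
  Rounding the coefficient of \<open>u\<close> to an integer leads back to a multiple of \<open>v\<close> and costs at most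
  \<open>1 / (2 N) = 1 / n - 1 / (n + 1)\<close>.
\<close>

section \<open>Distance to the nearest integer\<close>

lemma dist_int_le: "dist_int x \<le> \<bar>x - of_int m\<bar>"
  unfolding dist_int_def by (rule round_diff_minimal)

lemma dist_int_minus: "dist_int (- x) = dist_int x"
proof (rule antisym)
  show "dist_int (- x) \<le> dist_int x"
    using dist_int_le[of "- x" "- round x"] by (simp add: dist_int_def[of x])
  show "dist_int x \<le> dist_int (- x)"
    using dist_int_le[of x "- round (- x)"] by (simp add: dist_int_def[of "- x"])
qed

lemma dist_int_perturb: "dist_int (x + of_int m + e) \<le> dist_int x + \<bar>e\<bar>"
  using dist_int_le[of "x + of_int m + e" "round x + m"] by (simp add: dist_int_def[of x])

text \<open>Transfer along a bijection, so that one index can later be dropped from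
  \<open>{1..n}\<close>.\<close>

lemma lonely_runner_conjecture_on:
  assumes "lonely_runner_conjecture (Suc (card J))" "finite J" "\<And>i. i \<in> J \<Longrightarrow> w i \<noteq> 0"
  obtains t where "\<And>i. i \<in> J \<Longrightarrow> dist_int (w i * t) \<ge> 1 / real (Suc (card J))"
proof -
  obtain h where h: "bij_betw h {1..card J} J"
    using ex_bij_betw_nat_finite_1[OF assms(2)] by blast
  have "\<forall>i\<in>{1..<Suc (card J)}. w (h i) \<noteq> 0"
    using assms(3) bij_betwE[OF h] by auto
  then obtain t where t: "\<forall>i\<in>{1..<Suc (card J)}. dist_int (w (h i) * t) \<ge> 1 / real (Suc (card J))"
    using assms(1)[unfolded lonely_runner_conjecture_def, rule_format, of "\<lambda>i. w (h i)"] by blast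
  show ?thesis
  proof (rule that)
    fix i assume "i \<in> J"
    then obtain m where "m \<in> {1..card J}" "i = h m"
      using bij_betw_imp_surj_on[OF h] by blast
    with t show "dist_int (w i * t) \<ge> 1 / real (Suc (card J))" by auto
  qed
qed

section \<open>Primitive vectors and the pigeonhole principle\<close>

lemma dvd_of_dvd_mult_Gcd_1:
  fixes v :: "'a \<Rightarrow> nat" and c d :: int
  assumes "Gcd (v ` I) = 1" "\<And>i. i \<in> I \<Longrightarrow> d dvd c * int (v i)"
  shows "d dvd c"
proof -
  have "nat \<bar>d\<bar> dvd nat \<bar>c\<bar> * v i" if "i \<in> I" for i
  proof -
    have "nat \<bar>d\<bar> dvd nat \<bar>c * int (v i)\<bar>"
      using assms(2)[OF that] by (simp add: nat_abs_dvd_iff)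
    then show ?thesis by (simp add: nat_abs_mult_distrib)
  qed
  then have "nat \<bar>d\<bar> dvd Gcd ((*) (nat \<bar>c\<bar>) ` v ` I)"
    by (intro Gcd_greatest) auto
  also have "\<dots> = nat \<bar>c\<bar>"
    using assms(1) by (simp only: Gcd_mult) simp
  finally show ?thesis by (simp add: nat_abs_dvd_iff)
qed

text \<open>For a fixed \<open>i\<close>, \<open>v i\<close> divides \<open>u i * v j\<close> for
  all \<open>j\<close>, hence divides \<open>u i\<close>; the quotient is the factor.\<close>

lemma parallel_primitive_imp_multiple:
  fixes v :: "'a \<Rightarrow> nat" and u :: "'a \<Rightarrow> int"
  assumes "Gcd (v ` I) = 1" "\<And>i. i \<in> I \<Longrightarrow> v i > 0"
    and par: "\<And>i j. i \<in> I \<Longrightarrow> j \<in> I \<Longrightarrow> u i * int (v j) = u j * int (v i)"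
  obtains k where "\<And>i. i \<in> I \<Longrightarrow> u i = k * int (v i)"
proof -
  have "I \<noteq> {}" using assms(1) by auto
  then obtain i where i: "i \<in> I" by blast
  have "int (v i) dvd u i"
    using assms(1) by (rule dvd_of_dvd_mult_Gcd_1) (simp add: par[OF i])
  then obtain k where k: "u i = int (v i) * k" by (elim dvdE)
  show ?thesis
  proof (rule that)
    fix j assume "j \<in> I"
    from par[OF i this] k have "int (v i) * (k * int (v j)) = int (v i) * u j"
      by (simp add: ac_simps)
    then show "u j = k * int (v j)" using assms(2)[OF i] by simp
  qed
qed

text \<open>The vectors \<^term>\<open>z p\<close> have at most \<open>N ^ (card I - 1)\<close> residue classes modulo
  \<^term>\<open>N\<close> and \<^term>\<open>v\<close>, because the class of \<^term>\<open>v\<close> modulo \<^term>\<open>N\<close> has order exactly \<^term>\<open>N\<close>.\<close>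

lemma pigeonhole_mod_primitive:
  fixes v :: "'a \<Rightarrow> nat" and z :: "'p \<Rightarrow> 'a \<Rightarrow> int" and N :: nat
  assumes "finite I" "Gcd (v ` I) = 1" "N > 0"
    and card: "card P > N ^ (card I - 1)"
  obtains p q k u where "p \<in> P" "q \<in> P" "p \<noteq> q"
    "\<And>i. i \<in> I \<Longrightarrow> z p i - z q i + k * int (v i) = int N * u i"
proof -
  have "I \<noteq> {}" using assms(2) by auto
  \<comment> \<open>Running through \<open>N\<close> multiples of \<open>v\<close> avoids forming a
    quotient: \<open>card P * N\<close> pairs face only \<open>N ^ card I\<close> residue
    vectors.\<close>
  define F where "F = (\<lambda>(p, k). \<lambda>i\<in>I. (z p i + int k * int (v i)) mod int N)"
  have "\<not> inj_on F (P \<times> {..<N})"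
  proof
    assume "inj_on F (P \<times> {..<N})"
    moreover have "F ` (P \<times> {..<N}) \<subseteq> PiE I (\<lambda>_. {0..<int N})"
      using assms(3) by (auto simp: F_def PiE_def extensional_def)
    ultimately have "card (P \<times> {..<N}) \<le> card (PiE I (\<lambda>_. {0..<int N}))"
      by (rule card_inj_on_le) (simp add: assms(1) finite_PiE)
    also have "\<dots> = N ^ (card I - 1) * N"
      using assms(1) \<open>I \<noteq> {}\<close>
      by (simp add: card_PiE card_gt_0_iff flip: power_Suc2)
    also have "\<dots> < card P * N" using card assms(3) by simp
    finally show False by (simp add: card_cartesian_product)
  qed
  then obtain p k q l where pk: "p \<in> P" "q \<in> P" "k < N" "l < N" "(p, k) \<noteq> (q, l)"
    and F: "F (p, k) = F (q, l)"
    by (auto simp: inj_on_def)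
  have dvd: "int N dvd z p i - z q i + (int k - int l) * int (v i)" if "i \<in> I" for i
  proof -
    have "(z p i + int k * int (v i)) mod int N = (z q i + int l * int (v i)) mod int N"
      using fun_cong[OF F, of i] that by (simp add: F_def)
    then show ?thesis by (simp add: mod_eq_dvd_iff algebra_simps)
  qed
  have "p \<noteq> q"
  proof
    assume "p = q"
    then have "int N dvd (int k - int l) * int (v i)" if "i \<in> I" for i
      using dvd[OF that] by simp
    with assms(2) have "int N dvd int k - int l" by (rule dvd_of_dvd_mult_Gcd_1)
    then have "int k - int l = 0"
      using pk(3,4) dvd_imp_le_int[of "int k - int l" "int N"] by force
    with pk(5) \<open>p = q\<close> show False by simp
  qed
  moreover have "z p i - z q i + (int k - int l) * int (v i)
      = int N * ((z p i - z q i + (int k - int l) * int (v i)) div int N)" if "i \<in> I" for i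
    using dvd[OF that] by simp
  ultimately show ?thesis using pk(1,2) by (intro that) auto
qed

section \<open>Lattice points of the projected cube\<close>

text \<open>Here \<^term>\<open>(S, a)\<close> encodes the set \<open>S\<close> together with the parameter \<open>s = a / Gcd (v ` S)\<close>.
  As \<open>Gcd (v ` {}) = 0\<close>, the empty set contributes no pair.\<close>

definition zono_index :: "('a \<Rightarrow> nat) \<Rightarrow> 'a set \<Rightarrow> ('a set \<times> nat) set"
  where "zono_index v I = (SIGMA S:Pow I. {..<Gcd (v ` S)})"

definition zono_param :: "('a \<Rightarrow> nat) \<Rightarrow> 'a set \<times> nat \<Rightarrow> real"
  where "zono_param v = (\<lambda>(S, a). real a / real (Gcd (v ` S)))"

definition zono_point :: "('a \<Rightarrow> nat) \<Rightarrow> 'a set \<times> nat \<Rightarrow> 'a \<Rightarrow> int"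
  where "zono_point v = (\<lambda>p i. \<lfloor>zono_param v p * real (v i)\<rfloor> + (if i \<in> fst p then 0 else 1))"

lemma card_zono_index: "finite I \<Longrightarrow> card (zono_index v I) = (\<Sum>S\<in>Pow I. Gcd (v ` S))"
  by (simp add: zono_index_def)

lemma zono_param_bounds:
  assumes "p \<in> zono_index v I"
  shows "0 \<le> zono_param v p" "zono_param v p < 1"
  using assms by (auto simp: zono_index_def zono_param_def)

lemma zono_index_Gcd_nonzero:
  assumes "p \<in> zono_index v I"
  shows "Gcd (v ` fst p) \<noteq> 0"
proof -
  have "snd p < Gcd (v ` fst p)" using assms by (auto simp: zono_index_def)
  then show ?thesis by linarith
qed

lemma floor_zono_param_mult:
  assumes "p \<in> zono_index v I" "i \<in> fst p"
  shows "of_int \<lfloor>zono_param v p * real (v i)\<rfloor> = zono_param v p * real (v i)"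
proof -
  obtain m where m: "v i = Gcd (v ` fst p) * m"
    using assms(2) by (metis Gcd_dvd dvdE imageI)
  have "zono_param v p * real (v i) = of_int (int (snd p * m))"
    using zono_index_Gcd_nonzero[OF assms(1)]
    by (subst m) (simp add: zono_param_def split_beta del: Gcd_0_iff)
  then show ?thesis by (simp only: floor_of_int)
qed

text \<open>The offset \<open>z - s v\<close> lies in the unit cube, so \<open>z\<close> projects
  into the projected cube.\<close>

lemma zono_point_bounds:
  assumes "p \<in> zono_index v I"
  shows "0 \<le> zono_point v p i - zono_param v p * real (v i)"
    and "zono_point v p i - zono_param v p * real (v i) \<le> 1"
  using floor_zono_param_mult[OF assms, of i] unfolding zono_point_def
  by (cases "i \<in> fst p"; simp; linarith)+

lemma zono_point_eq_iff:
  assumes "p \<in> zono_index v I"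
  shows "zono_point v p i = zono_param v p * real (v i) \<longleftrightarrow> i \<in> fst p"
proof (cases "i \<in> fst p")
  case True
  with floor_zono_param_mult[OF assms True] show ?thesis by (simp add: zono_point_def)
next
  case False
  have "zono_param v p * real (v i) < real_of_int (zono_point v p i)"
    using False unfolding zono_point_def by simp
  with False show ?thesis by simp
qed

lemma zono_point_inj_mod:
  fixes v :: "'a \<Rightarrow> nat"
  assumes p: "p \<in> zono_index v I" and q: "q \<in> zono_index v I"
    and pos: "\<And>i. i \<in> I \<Longrightarrow> v i > 0"
    and eq: "\<And>i. i \<in> I \<Longrightarrow> zono_point v p i = zono_point v q i + k * int (v i)"
  shows "p = q"
proof -
  let ?s = "zono_param v p" and ?t = "zono_param v q + of_int k"
  have sub: "fst p \<subseteq> I" "fst q \<subseteq> I"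
    using p q by (auto simp: zono_index_def)
  have ne: "fst p \<noteq> {}" "fst q \<noteq> {}"
    using zono_index_Gcd_nonzero[OF p] zono_index_Gcd_nonzero[OF q] by auto
  have eq': "zono_point v p i - ?t * real (v i) = zono_point v q i - zono_param v q * real (v i)"
    if "i \<in> I" for i
    using eq[OF that] by (simp add: algebra_simps)
  obtain i where i: "i \<in> fst p" using ne by blast
  \<comment> \<open>At a coordinate in \<open>fst p\<close> the offset from \<open>?s * v\<close>
    vanishes, while the offset from \<open>?t * v\<close> is nonnegative.\<close>
  have "?t * real (v i) \<le> ?s * real (v i)"
    using zono_point_bounds(1)[OF q, of i] eq'[of i] zono_point_eq_iff[OF p, of i] i sub by auto
  then have "?t \<le> ?s" using pos i sub by auto
  moreover obtain j where j: "j \<in> fst q" using ne by blast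
  have "?s * real (v j) \<le> ?t * real (v j)"
    using zono_point_bounds(1)[OF p, of j] eq'[of j] zono_point_eq_iff[OF q, of j] j sub by auto
  then have "?s \<le> ?t" using pos j sub by auto
  ultimately have st: "?s = ?t" by simp
  then have "k = 0" using zono_param_bounds[OF p] zono_param_bounds[OF q] by linarith
  have "i \<in> fst p \<longleftrightarrow> i \<in> fst q" if "i \<in> I" for i
    using zono_point_eq_iff[OF p, of i] zono_point_eq_iff[OF q, of i] eq[OF that] st \<open>k = 0\<close>
    by simp
  then have "fst p = fst q" using sub by blast
  moreover from this have "snd p = snd q"
    using st \<open>k = 0\<close> zono_index_Gcd_nonzero[OF p]
    by (simp add: zono_param_def split_beta del: Gcd_0_iff)
  ultimately show ?thesis by (simp add: prod_eq_iff)
qed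

lemma nonparallel_vector_near_line:
  fixes v :: "'a \<Rightarrow> nat" and N :: nat
  assumes "finite I" "\<And>i. i \<in> I \<Longrightarrow> v i > 0" "Gcd (v ` I) = 1" "N > 0"
    and "(\<Sum>S\<in>Pow I. Gcd (v ` S)) > N ^ (card I - 1)"
  obtains u :: "'a \<Rightarrow> int" and \<sigma> :: real and i j where
    "i \<in> I" "j \<in> I" "u i * int (v j) \<noteq> u j * int (v i)"
    "\<And>k. k \<in> I \<Longrightarrow> \<bar>u k - \<sigma> * real (v k)\<bar> \<le> 1 / real N"
proof -
  have "card (zono_index v I) > N ^ (card I - 1)"
    using assms(1,5) by (simp add: card_zono_index)
  from pigeonhole_mod_primitive[OF assms(1,3,4) this, of "zono_point v"]
  obtain p q k u where p: "p \<in> zono_index v I" and q: "q \<in> zono_index v I" and "p \<noteq> q"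
    and u: "\<And>i. i \<in> I \<Longrightarrow> zono_point v p i - zono_point v q i + k * int (v i) = int N * u i"
    by metis
  have "\<exists>i\<in>I. \<exists>j\<in>I. u i * int (v j) \<noteq> u j * int (v i)"
  proof (rule ccontr)
    assume "\<not> ?thesis"
    then obtain m where m: "\<And>i. i \<in> I \<Longrightarrow> u i = m * int (v i)"
      using parallel_primitive_imp_multiple[of v I u] assms(2,3) by blast
    have "zono_point v p i = zono_point v q i + (int N * m - k) * int (v i)" if "i \<in> I" for i
      using u[OF that] m[OF that] by (simp add: algebra_simps)
    from zono_point_inj_mod[OF p q assms(2) this] \<open>p \<noteq> q\<close> show False by blast
  qed
  moreover
  \<comment> \<open>With this slope, \<open>N * (u - \<sigma> v)\<close> is a difference of two
    vectors of the unit cube, so its entries are at most 1 in absolute value.\<close>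
  define \<sigma> where "\<sigma> = (zono_param v p - zono_param v q + of_int k) / real N"
  have "\<bar>u i - \<sigma> * real (v i)\<bar> \<le> 1 / real N" if "i \<in> I" for i
  proof -
    have "real N * \<sigma> = zono_param v p - zono_param v q + of_int k"
      using assms(4) by (simp add: \<sigma>_def)
    then have "real N * (u i - \<sigma> * real (v i))
        = of_int (int N * u i) - (zono_param v p - zono_param v q + of_int k) * real (v i)"
      by (simp add: right_diff_distrib flip: mult.assoc)
    also have "\<dots> = (zono_point v p i - zono_param v p * real (v i))
        - (zono_point v q i - zono_param v q * real (v i))"
      by (simp add: algebra_simps flip: u[OF that])
    finally have "\<bar>real N * (u i - \<sigma> * real (v i))\<bar> \<le> 1"
      using zono_point_bounds[OF p, of i] zono_point_bounds[OF q, of i] by linarith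
    then have "\<bar>u i - \<sigma> * real (v i)\<bar> * real N \<le> 1" by (simp add: abs_mult mult.commute)
    then show ?thesis using assms(4) by (simp add: pos_le_divide_eq)
  qed
  ultimately show ?thesis using that by blast
qed

section \<open>A mediant that differs from all ratios\<close>

lemma obtain_mediant_avoiding:
  fixes v u :: "'a \<Rightarrow> int"
  assumes "finite I" "\<And>i. i \<in> I \<Longrightarrow> v i > 0"
    and "\<exists>i\<in>I. \<exists>j\<in>I. u i * v j \<noteq> u j * v i"
  obtains i j where "i \<in> I" "j \<in> I" "i \<noteq> j"
    "\<And>k. k \<in> I \<Longrightarrow> (v i + v j) * u k \<noteq> (u i + u j) * v k"
proof -
  define r where "r k = real_of_int (u k) / real_of_int (v k)" for k
  have less_iff: "r k < r l \<longleftrightarrow> u k * v l < u l * v k" if "k \<in> I" "l \<in> I" for k l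
  proof -
    have "r k < r l \<longleftrightarrow> real_of_int (u k * v l) < real_of_int (u l * v k)"
      using assms(2)[OF that(1)] assms(2)[OF that(2)] by (simp add: r_def divide_simps)
    then show ?thesis by (simp only: of_int_less_iff)
  qed
  have "I \<noteq> {}" using assms(3) by auto
  \<comment> \<open>\<open>r i\<close> is the smallest ratio and \<open>r j\<close> the next larger
    one; no ratio lies strictly between them, but the mediant does.\<close>
  then obtain i where i: "i \<in> I" and imin: "\<And>k. k \<in> I \<Longrightarrow> \<not> r k < r i"
    using arg_min_if_finite[OF assms(1), of r] by blast
  let ?J = "{k \<in> I. r i < r k}"
  have "?J \<noteq> {}"
  proof
    assume *: "?J = {}"
    have "r k = r i" if "k \<in> I" for k
      using imin[OF that] * that by (auto simp: not_less order.antisym)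
    then show False using assms(3) less_iff by (metis less_irrefl neqE)
  qed
  then obtain j where j: "j \<in> I" "r i < r j" and jmin: "\<And>k. k \<in> I \<Longrightarrow> r i < r k \<Longrightarrow> \<not> r k < r j"
    using arg_min_if_finite[of ?J r] assms(1) by auto
  show ?thesis
  proof (rule that[of i j])
    fix k assume k: "k \<in> I"
    show "(v i + v j) * u k \<noteq> (u i + u j) * v k"
    proof
      assume eq: "(v i + v j) * u k = (u i + u j) * v k"
      show False
      proof (cases "r i < r k")
        case True
        then have "u i * v k < u k * v i" "u j * v k \<le> u k * v j"
          using jmin[OF k] less_iff k i j by (auto simp: not_less)
        with eq show False by (simp add: algebra_simps)
      next
        case False
        with j have "r k < r j" by simp
        with False have "u k * v i \<le> u i * v k" "u k * v j < u j * v k"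
          using less_iff k i j by (auto simp: not_less)
        with eq show False by (simp add: algebra_simps)
      qed
    qed
  qed (use i j in auto)
qed

section \<open>From a time for \<open>w\<close> to a time for \<open>v\<close>\<close>

theorem theorem1:
  fixes n :: nat and v :: "nat \<Rightarrow> nat"
  assumes "n \<ge> 1"
    and "lonely_runner_conjecture n"
    and "\<forall>i\<in>{1..n}. v i > 0"
    and "Gcd (v ` {1..n}) = 1"
    and "(\<Sum>S\<in>Pow {1..n}. Gcd (v ` S)) > ((n + 1) choose 2) ^ (n - 1)"
  shows "\<exists>t :: real. \<forall>i\<in>{1..n}. dist_int (real (v i) * t) \<ge> 1 / (real n + 1)"
proof -
  define N where "N = (n + 1) choose 2"
  have N: "N > 0" using assms(1) by (simp add: N_def)
  have "2 * N = n * (n + 1)" unfolding N_def choose_two by simp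
  then have "2 * real N = real n * (real n + 1)"
    by (metis of_nat_mult of_nat_numeral of_nat_add of_nat_1)
  then have gap: "1 / real n - 1 / (2 * real N) = 1 / (real n + 1)"
    using assms(1) by (simp add: divide_simps)
  have "(\<Sum>S\<in>Pow {1..n}. Gcd (v ` S)) > N ^ (card {1..n} - 1)"
    using assms(5) by (simp add: N_def)
  then obtain u \<sigma> i' j' where "i' \<in> {1..n}" "j' \<in> {1..n}" "u i' * int (v j') \<noteq> u j' * int (v i')"
    and near: "\<And>k. k \<in> {1..n} \<Longrightarrow> \<bar>u k - \<sigma> * real (v k)\<bar> \<le> 1 / real N"
    using nonparallel_vector_near_line[OF finite_atLeastAtMost _ assms(4) N] assms(3) by metis
  then obtain i j where ij: "i \<in> {1..n}" "j \<in> {1..n}" "i \<noteq> j"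
    and nz: "\<And>k. k \<in> {1..n} \<Longrightarrow> (int (v i) + int (v j)) * u k \<noteq> (u i + u j) * int (v k)"
    using obtain_mediant_avoiding[of "{1..n}" "\<lambda>k. int (v k)" u] assms(3)
    by (metis finite_atLeastAtMost of_nat_0_less_iff)
  define A B where "A = int (v i) + int (v j)" and "B = u i + u j"
  define w where "w k = real_of_int (A * u k - B * int (v k))" for k
  have "Suc (card ({1..n} - {j})) = n" using ij by simp
  moreover have "w k \<noteq> 0" if "k \<in> {1..n}" for k
    using nz[OF that] unfolding w_def A_def B_def of_int_eq_0_iff by simp
  ultimately obtain t where t: "\<And>k. k \<in> {1..n} - {j} \<Longrightarrow> dist_int (w k * t) \<ge> 1 / real n"
    using lonely_runner_conjecture_on[of "{1..n} - {j}" w] assms(2) by auto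
  have "w j = - w i" by (simp add: w_def A_def B_def algebra_simps)
  then have tj: "dist_int (w k * t) \<ge> 1 / real n" if "k \<in> {1..n}" for k
    using t[of k] t[of i] that ij by (cases "k = j") (auto simp: dist_int_minus)
  define m e where "m = round (A * t)" and "e = A * t - m"
  have e: "\<bar>e\<bar> \<le> 1 / 2"
    using of_int_round_abs_le[of "A * t"] by (simp add: m_def e_def abs_minus_commute)
  \<comment> \<open>Put \<open>A * t = m + e\<close> into \<open>w k * t\<close> and replace
    \<open>e * u k\<close> by \<open>e * \<sigma> * v k\<close>: \<open>T\<close> is the resulting
    coefficient of \<open>v k\<close>, and \<open>m * u k\<close> is an integer.\<close>
  define T where "T = e * \<sigma> - B * t"
  have "dist_int (real (v k) * T) \<ge> 1 / (real n + 1)" if k: "k \<in> {1..n}" for k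
  proof -
    have "\<bar>e * (u k - \<sigma> * real (v k))\<bar> \<le> 1 / 2 * (1 / real N)"
      unfolding abs_mult using e near[OF k] by (intro mult_mono) auto
    moreover have "w k * t = real (v k) * T + of_int (m * u k) + e * (u k - \<sigma> * real (v k))"
      by (simp add: w_def T_def e_def algebra_simps)
    ultimately show ?thesis
      using dist_int_perturb[of "real (v k) * T" "m * u k" "e * (u k - \<sigma> * real (v k))"]
        tj[OF k] gap by simp
  qed
  then show ?thesis by blast
qed

end
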